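(* Let $G=(V,E)$ be a complete undirected graph with $|V|\ge3$, let $w:2^E\to\mathbb{R}_{\ge0}$ be a monotone submodular function, let $c:E\to\mathbb{R}_{\ge0}$ be edge costs with $c(S)=\sum_{e\in S}c(e)$, let $M=\max_{e\in E}c(e)$, let $\beta\in[0,1]$, and let $$f(S)=(1-\beta)w(S)-\beta c(S),\qquad S\subseteq E.$$ Let $\mathcal{H}$ be the set of (edge sets of) all tours of $G$ and $\mathrm{OPT}=\max_{S\in\mathcal{H}}f(S)$. Then the greedy tour algorithm, run with objective $f$, outputs a tour $T$ with $$f(T)\ \ge\ \frac13\,\mathrm{OPT}-\frac23\,\beta M|V|.$$
   Context: A tour is (the edge set of) a Hamiltonian cycle of $G$; a subtour is a simple cycle that is not a tour. A function $w$ is submodular if $w(S)+w(T)\ge w(S\cup T)+w(S\cap T)$ for all $S,T\subseteq E$, and monotone if $A\subseteq B$ implies $w(A)\le w(B)$. Greedy tour algorithm with objective $f$: start with current edge set $\emptyset$ and candidate set $E$. While the candidate set is nonempty and the current edge set $S$ has fewer than $|V|$ edges: let $e=\{u,v\}$ be a candidate edge maximizing $f(S\cup\{e\})-f(S)$. Add $e$ to $S$ if $u$ and $v$ both have degree less than $2$ in $(V,S)$ and adding $e$ creates no subtour. In either case remove $e$ from the candidate set. Output $S$. *)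

theory Defs
  imports Complex_Main
begin

definition complete_edges :: "'v set \<Rightarrow> 'v set set" where
  "complete_edges V = {e. e \<subseteq> V \<and> card e = 2}"

definition cycle_edges :: "'v list \<Rightarrow> 'v set set" where
  "cycle_edges xs = {{xs ! i, xs ! (Suc i mod length xs)} | i. i < length xs}"

definition simple_cycle :: "'v set \<Rightarrow> 'v set set \<Rightarrow> 'v set set \<Rightarrow> bool" where
  "simple_cycle V E C \<longleftrightarrow>
     (\<exists>xs. 3 \<le> length xs \<and> distinct xs \<and> set xs \<subseteq> V \<and> C = cycle_edges xs \<and> C \<subseteq> E)"

definition tours :: "'v set \<Rightarrow> 'v set set \<Rightarrow> 'v set set set" where
  "tours V E = {C. simple_cycle V E C \<and> \<Union>C = V}"

definition subtour :: "'v set \<Rightarrow> 'v set set \<Rightarrow> 'v set set \<Rightarrow> bool" where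
  "subtour V E C \<longleftrightarrow> simple_cycle V E C \<and> C \<notin> tours V E"

definition degree :: "'v set set \<Rightarrow> 'v \<Rightarrow> nat" where
  "degree S v = card {e \<in> S. v \<in> e}"

definition submodular_on :: "'e set \<Rightarrow> ('e set \<Rightarrow> real) \<Rightarrow> bool" where
  "submodular_on E w \<longleftrightarrow>
     (\<forall>S T. S \<subseteq> E \<longrightarrow> T \<subseteq> E \<longrightarrow> w (S \<union> T) + w (S \<inter> T) \<le> w S + w T)"

definition objective :: "real \<Rightarrow> ('e set \<Rightarrow> real) \<Rightarrow> ('e \<Rightarrow> real) \<Rightarrow> 'e set \<Rightarrow> real" where
  "objective \<beta> w c S = (1 - \<beta>) * w S - \<beta> * (\<Sum>e\<in>S. c e)"

definition can_add :: "'v set \<Rightarrow> 'v set set \<Rightarrow> 'v set set \<Rightarrow> 'v set \<Rightarrow> bool" where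
  "can_add V E S e \<longleftrightarrow>
     (\<forall>v\<in>e. degree S v < 2) \<and> \<not> (\<exists>C. subtour V E C \<and> C \<subseteq> S \<union> {e} \<and> e \<in> C)"

text \<open>
  A state is a pair of the current edge set and the candidate set. Ties between maximizing
  candidates are left open, so the algorithm is a relation; \<open>greedy_step\<close> is one loop iteration.
\<close>

inductive greedy_step ::
  "'v set \<Rightarrow> 'v set set \<Rightarrow> ('v set set \<Rightarrow> real) \<Rightarrow>
   'v set set \<times> 'v set set \<Rightarrow> 'v set set \<times> 'v set set \<Rightarrow> bool"
  for V E f where
  add: "C \<noteq> {} \<Longrightarrow> card S < card V \<Longrightarrow>
        is_arg_max (\<lambda>e. f (S \<union> {e}) - f S) (\<lambda>e. e \<in> C) e \<Longrightarrow> can_add V E S e \<Longrightarrow>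
        greedy_step V E f (S, C) (S \<union> {e}, C - {e})"
| skip: "C \<noteq> {} \<Longrightarrow> card S < card V \<Longrightarrow>
        is_arg_max (\<lambda>e. f (S \<union> {e}) - f S) (\<lambda>e. e \<in> C) e \<Longrightarrow> \<not> can_add V E S e \<Longrightarrow>
        greedy_step V E f (S, C) (S, C - {e})"

definition greedy_output ::
  "'v set \<Rightarrow> 'v set set \<Rightarrow> ('v set set \<Rightarrow> real) \<Rightarrow> 'v set set \<Rightarrow> bool" where
  "greedy_output V E f T \<longleftrightarrow>
     (\<exists>C. (greedy_step V E f)\<^sup>*\<^sup>* ({}, E) (T, C) \<and> \<not> (C \<noteq> {} \<and> card T < card V))"

text \<open>Each iteration shrinks the candidate set, so on a finite graph every run terminates.\<close>

lemma greedy_step_candidates: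
  "greedy_step V E f (S, C) (S', C') \<Longrightarrow> C' \<subset> C"
  by (erule greedy_step.cases) (auto simp: is_arg_max_def)

end

theory Submission
  imports Defs
begin

text \<open>
  Write \<open>f\<close> for the objective, \<open>M\<close> for the largest edge cost and \<open>g S = f S + \<beta> * M * card S\<close>.
  Replacing each cost \<open>c e\<close> by \<open>c e - M\<close> makes \<open>g\<close> monotone and submodular, whereas \<open>f\<close> need not be
  monotone. Since the marginals of \<open>f\<close> and \<open>g\<close> differ by the constant \<open>\<beta> * M\<close>, both functions have
  the same greedy runs, and on tours they differ by the constant \<open>\<beta> * M * card V\<close>. So it
  suffices that the greedy output \<open>T\<close> is a tour with \<open>3 * g T \<ge> g Q\<close> for every tour \<open>Q\<close>; the
  additive loss \<open>2 / 3 * \<beta> * M * card V\<close> is what remains after translating this back to \<open>f\<close>.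

  The factor \<open>3\<close> is that of greedy on a 2-system: at any time, at most \<open>2 * card S\<close> edges of \<open>Q\<close>
  have been examined. Indeed, the degrees in \<open>S\<close> of the two ends of an examined edge add up to at
  least \<open>2\<close> (\<open>rejected_edge_degree_sum\<close>), while each vertex lies on at most
  two edges of \<open>Q\<close>; summing the degrees in \<open>S\<close> over the examined edges of \<open>Q\<close> gives the
  claim (\<open>card_le_twice_if_degrees_met\<close>). Given this count, each edge of \<open>Q\<close> can be charged to
  an accepted edge whose gain was at least as large, each accepted edge being charged at most twice. The
  invariant \<open>charged\<close> keeps the account without choosing an assignment. Hence the
  marginals of \<open>Q\<close> over \<open>T\<close> sum to at most \<open>2 * (g T - g {})\<close>, and submodularity bounds \<open>g Q\<close> by
  \<open>g T\<close> plus that sum.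

  That the output is a tour is a matter of graph theory. If all degrees are \<open>2\<close>, a maximal path closes
  up to a cycle, which must be a tour. Otherwise some edge can still be added
  (\<open>low_degree_edge_addable\<close>): either two vertices of degree below \<open>2\<close> lie in different components,
  and no cycle crosses a cut exactly once, or the edge set is connected and its two ends can be
  joined, as any cycle through the new edge visits every vertex.
\<close>

section \<open>Degrees and double counting\<close>

lemma finite_complete_edges: "finite V \<Longrightarrow> finite (complete_edges V)"
  unfolding complete_edges_def by (rule finite_subset[of _ "Pow V"]) auto

lemma complete_edgesD:
  assumes "e \<in> complete_edges V"
  obtains u v where "e = {u, v}" "u \<noteq> v" "u \<in> V" "v \<in> V"
proof -
  have "card e = 2" "e \<subseteq> V" using assms by (auto simp: complete_edges_def)
  then obtain u v where "e = {u, v}" "u \<noteq> v" by (auto simp: card_2_iff)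
  then show ?thesis using that \<open>e \<subseteq> V\<close> by auto
qed

lemma degree_mono: "finite T \<Longrightarrow> S \<subseteq> T \<Longrightarrow> degree S v \<le> degree T v"
  unfolding degree_def by (intro card_mono) auto

lemma degree_insert:
  assumes "finite S" and "e \<notin> S"
  shows "degree (insert e S) v = degree S v + (if v \<in> e then 1 else 0)"
proof -
  have "{f \<in> insert e S. v \<in> f} = (if v \<in> e then insert e {f \<in> S. v \<in> f} else {f \<in> S. v \<in> f})"
    by auto
  then show ?thesis using assms by (auto simp: degree_def)
qed

lemma sum_degree_weighted:
  fixes k :: "'v \<Rightarrow> nat"
  assumes "finite F" and "finite X"
  shows "(\<Sum>v\<in>X. degree F v * k v) = (\<Sum>e\<in>F. \<Sum>v\<in>X \<inter> e. k v)"
proof -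
  have "(\<Sum>v\<in>X. degree F v * k v) = (\<Sum>v\<in>X. \<Sum>e\<in>F. if v \<in> e then k v else 0)"
    using assms(1) by (intro sum.cong) (auto simp: degree_def sum.inter_filter[symmetric])
  also have "\<dots> = (\<Sum>e\<in>F. \<Sum>v\<in>X. if v \<in> e then k v else 0)"
    by (rule sum.swap)
  also have "\<dots> = (\<Sum>e\<in>F. \<Sum>v\<in>X \<inter> e. k v)"
    using assms(2) by (simp add: sum.inter_restrict)
  finally show ?thesis .
qed

lemma handshake:
  assumes "finite V" and "F \<subseteq> complete_edges V"
  shows "(\<Sum>v\<in>V. degree F v) = 2 * card F"
proof -
  have "finite F" using assms finite_complete_edges finite_subset by blast
  then have "(\<Sum>v\<in>V. degree F v) = (\<Sum>e\<in>F. card (V \<inter> e))"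
    using sum_degree_weighted[of F V "\<lambda>_. 1"] assms(1) by simp
  also have "\<dots> = (\<Sum>e\<in>F. 2)"
    using assms(2) by (intro sum.cong) (auto simp: complete_edges_def Int_absorb1)
  finally show ?thesis by simp
qed

text \<open>
  Summing the degrees in \<open>S\<close> over all ends of edges of \<open>F\<close> gives at least \<open>2 * card F\<close>. The same sum
  counts the degree in \<open>S\<close> of each vertex at most twice, so it is at most \<open>4 * card S\<close>.
\<close>

lemma card_le_twice_if_degrees_met:
  assumes "finite V" and "S \<subseteq> complete_edges V" and "F \<subseteq> complete_edges V"
    and F: "\<And>v. v \<in> V \<Longrightarrow> degree F v \<le> 2"
    and S: "\<And>e. e \<in> F \<Longrightarrow> 2 \<le> (\<Sum>v\<in>e. degree S v)"
  shows "card F \<le> 2 * card S"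
proof -
  have "finite F" using assms(1,3) finite_complete_edges finite_subset by blast
  have "2 * card F = (\<Sum>e\<in>F. 2)" by simp
  also have "\<dots> \<le> (\<Sum>e\<in>F. \<Sum>v\<in>e. degree S v)" by (intro sum_mono S)
  also have "\<dots> = (\<Sum>e\<in>F. \<Sum>v\<in>V \<inter> e. degree S v)"
    using assms(3) by (intro sum.cong) (auto simp: complete_edges_def Int_absorb1)
  also have "\<dots> = (\<Sum>v\<in>V. degree F v * degree S v)"
    using sum_degree_weighted[OF \<open>finite F\<close> assms(1)] by simp
  also have "\<dots> \<le> (\<Sum>v\<in>V. 2 * degree S v)"
    by (intro sum_mono mult_right_mono F) auto
  also have "\<dots> = 2 * (2 * card S)"
    using handshake[OF assms(1,2)] by (simp add: sum_distrib_left[symmetric])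
  finally show ?thesis by simp
qed

section \<open>Cycles\<close>

lemma Union_cycle_edges:
  assumes "xs \<noteq> []"
  shows "\<Union>(cycle_edges xs) = set xs"
proof
  show "\<Union>(cycle_edges xs) \<subseteq> set xs" using assms by (auto simp: cycle_edges_def)
  show "set xs \<subseteq> \<Union>(cycle_edges xs)"
  proof
    fix v assume "v \<in> set xs"
    then obtain i where "i < length xs" "v = xs ! i" by (auto simp: in_set_conv_nth)
    then show "v \<in> \<Union>(cycle_edges xs)"
      unfolding cycle_edges_def by (intro UnionI[of "{xs ! i, xs ! (Suc i mod length xs)}"]) auto
  qed
qed

lemma finite_cycle_edges: "finite (cycle_edges xs)"
  unfolding cycle_edges_def by simp

lemma degree_cycle_edges:
  assumes "distinct xs" and "3 \<le> length xs" and "v \<in> set xs"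
  shows "degree (cycle_edges xs) v = 2"
proof -
  define n where "n = length xs"
  obtain k where k: "k < n" "v = xs ! k" using assms(3) by (auto simp: in_set_conv_nth n_def)
  \<comment> \<open>The cyclic predecessor of \<open>k\<close>: exactly the edges leaving \<open>k\<close> and \<open>p\<close> contain \<open>v\<close>.\<close>
  define p where "p = (if k = 0 then n - 1 else k - 1)"
  have n: "3 \<le> n" using assms(2) by (simp add: n_def)
  have p: "p < n" "Suc p mod n = k" "p \<noteq> k"
    using k n by (auto simp: p_def)
  have p_unique: "i = p" if "i < n" "Suc i mod n = k" for i
    using that k n by (cases "Suc i = n") (auto simp: p_def)
  have inj: "xs ! i = xs ! j \<longleftrightarrow> i = j" if "i < n" "j < n" for i j
    using that assms(1) by (simp add: nth_eq_iff_index_eq n_def)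
  have sm: "Suc i mod n < n" for i using n by simp
  have "{e \<in> cycle_edges xs. v \<in> e} = {{v, xs ! (Suc k mod n)}, {xs ! p, v}}" (is "?L = ?R")
  proof
    show "?L \<subseteq> ?R"
    proof
      fix e assume "e \<in> ?L"
      then obtain i where i: "i < n" "e = {xs ! i, xs ! (Suc i mod n)}" "v \<in> e"
        by (auto simp: cycle_edges_def n_def)
      then have "i = k \<or> Suc i mod n = k" using inj k sm by auto
      then show "e \<in> ?R" using p_unique i k by auto
    qed
    show "?R \<subseteq> ?L"
    proof -
      have "{xs ! i, xs ! (Suc i mod n)} \<in> cycle_edges xs" if "i < n" for i
        using that by (auto simp: cycle_edges_def n_def)
      from this[OF k(1)] this[OF p(1)] show ?thesis using k(2) p(2) by auto
    qed
  qed
  moreover have "{v, xs ! (Suc k mod n)} \<noteq> {xs ! p, v}"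
  proof -
    have "Suc k mod n \<noteq> p"
      using k n by (cases "Suc k = n") (auto simp: p_def)
    then show ?thesis using inj k p sm by (auto simp: doubleton_eq_iff)
  qed
  ultimately show ?thesis by (simp add: degree_def)
qed

lemma simple_cycle_finite: "simple_cycle V E C \<Longrightarrow> finite C"
  by (auto simp: simple_cycle_def finite_cycle_edges)

lemma simple_cycle_subset: "simple_cycle V E C \<Longrightarrow> C \<subseteq> E"
  by (auto simp: simple_cycle_def)

lemma degree_simple_cycle:
  assumes "simple_cycle V E C"
  shows "degree C v = (if v \<in> \<Union>C then 2 else 0)"
proof -
  obtain xs where xs: "3 \<le> length xs" "distinct xs" "C = cycle_edges xs"
    using assms by (auto simp: simple_cycle_def)
  have "degree C v = 0" if "v \<notin> \<Union>C"
  proof -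
    have "{e \<in> C. v \<in> e} = {}" using that by auto
    then show ?thesis by (simp only: degree_def card.empty)
  qed
  moreover have "degree C v = 2" if "v \<in> \<Union>C"
  proof -
    have "xs \<noteq> []" using xs(1) by auto
    then have "v \<in> set xs" using that Union_cycle_edges[of xs] unfolding xs(3) by blast
    then show ?thesis using degree_cycle_edges[OF xs(2,1)] xs(3) by simp
  qed
  ultimately show ?thesis by (simp only: if_split) blast
qed

lemma tourD:
  assumes "finite V" and "C \<in> tours V (complete_edges V)"
  shows "C \<subseteq> complete_edges V" and "card C = card V" and "v \<in> V \<Longrightarrow> degree C v = 2"
proof -
  have C: "simple_cycle V (complete_edges V) C" "\<Union>C = V" using assms(2) by (auto simp: tours_def)
  show sub: "C \<subseteq> complete_edges V" by (rule simple_cycle_subset[OF C(1)])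
  show deg: "degree C v = 2" if "v \<in> V" for v using degree_simple_cycle[OF C(1)] C(2) that by simp
  have "2 * card C = (\<Sum>v\<in>V. 2)"
    unfolding handshake[OF assms(1) sub, symmetric] by (intro sum.cong deg) auto
  then show "card C = card V" by simp
qed

text \<open>
  A cycle crosses every cut an even number of times. The parity argument avoids following the cycle:
  the degree sum over \<open>X\<close> is even, and so is the contribution to it of each edge that does not
  cross.
\<close>

lemma cycle_cut_even:
  assumes cyc: "simple_cycle V (complete_edges V) C" and "finite V" and e: "e \<in> C"
    and X: "X \<subseteq> V" and closed: "\<And>f. f \<in> C - {e} \<Longrightarrow> f \<subseteq> X \<or> f \<inter> X = {}"
  shows "card (X \<inter> e) \<noteq> 1"
proof
  assume one: "card (X \<inter> e) = 1"
  have "finite C" by (rule simple_cycle_finite[OF cyc])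
  have "finite X" using X \<open>finite V\<close> finite_subset by blast
  have sub: "C \<subseteq> complete_edges V" by (rule simple_cycle_subset[OF cyc])
  have "(\<Sum>v\<in>X. degree C v) = (\<Sum>f\<in>C. card (X \<inter> f))"
    using sum_degree_weighted[OF \<open>finite C\<close> \<open>finite X\<close>, of "\<lambda>_. 1"] by simp
  also have "\<dots> = 1 + (\<Sum>f\<in>C - {e}. card (X \<inter> f))"
    using one by (simp add: sum.remove[OF \<open>finite C\<close> e])
  finally have eq: "(\<Sum>v\<in>X. degree C v) = 1 + (\<Sum>f\<in>C - {e}. card (X \<inter> f))" .
  have "even (\<Sum>v\<in>X. degree C v)"
    using degree_simple_cycle[OF cyc] by (intro dvd_sum) auto
  moreover have "even (\<Sum>f\<in>C - {e}. card (X \<inter> f))"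
  proof (intro dvd_sum)
    fix f assume f: "f \<in> C - {e}"
    then have "card f = 2" using sub by (auto simp: complete_edges_def)
    then show "even (card (X \<inter> f))"
      using closed[OF f] by (auto simp: Int_absorb1 Int_commute)
  qed
  ultimately show False using eq by simp
qed

text \<open>
  A cycle already uses up the two edges allowed at each of its vertices. Hence its vertex set is
  closed under adjacency in \<open>F\<close>, which in a connected graph forces it to be everything.
\<close>

lemma saturated_cycle_closed:
  assumes cyc: "simple_cycle V E C" and "C \<subseteq> F" and "finite F"
    and deg: "degree F v \<le> 2" and v: "v \<in> \<Union>C" and f: "f \<in> F" "v \<in> f"
  shows "f \<in> C"
proof (rule ccontr)
  assume "f \<notin> C"
  have "finite C" by (rule simple_cycle_finite[OF cyc])
  have "degree (insert f C) v = 3"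
    using degree_insert[OF \<open>finite C\<close> \<open>f \<notin> C\<close>] f degree_simple_cycle[OF cyc] v by simp
  moreover have "degree (insert f C) v \<le> degree F v"
    using assms by (intro degree_mono) auto
  ultimately show False using deg by simp
qed

section \<open>Maximal paths\<close>

text \<open>
  The path is extended at its head, which keeps \<open>x\<close> as its last vertex.
\<close>

lemma maximal_path:
  assumes "finite V" and "x \<in> V"
  obtains xs where "xs \<noteq> []" "distinct xs" "set xs \<subseteq> V" "successively (\<lambda>a b. {a, b} \<in> T) xs"
    "last xs = x" "\<And>z. z \<in> V \<Longrightarrow> {z, hd xs} \<in> T \<Longrightarrow> z \<in> set xs"
proof -
  define P where "P xs \<longleftrightarrow> xs \<noteq> [] \<and> distinct xs \<and> set xs \<subseteq> V \<and>
    successively (\<lambda>a b. {a, b} \<in> T) xs \<and> last xs = x" for xs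
  have "P [x]" using assms by (simp add: P_def)
  have bound: "length xs < Suc (card V)" if "P xs" for xs
    using that assms(1) by (metis P_def card_mono distinct_card le_imp_less_Suc)
  obtain xs where xs: "P xs" and max: "\<And>ys. P ys \<Longrightarrow> length ys \<le> length xs"
    using ex_has_greatest_nat[of P "[x]" length "Suc (card V)"] \<open>P [x]\<close> bound
    by (meson less_imp_le)
  have "z \<in> set xs" if z: "z \<in> V" "{z, hd xs} \<in> T" for z
  proof (rule ccontr)
    assume "z \<notin> set xs"
    then have "P (z # xs)" using xs z by (cases xs) (auto simp: P_def)
    then show False using max[of "z # xs"] by simp
  qed
  then show ?thesis using that xs by (auto simp: P_def)
qed

lemma successively_reachable:
  assumes "successively (\<lambda>a b. {a, b} \<in> T) xs" and "xs \<noteq> []"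
  shows "(last xs, hd xs) \<in> {(a, b). {a, b} \<in> T}\<^sup>*"
  using assms
proof (induction xs rule: induct_list012)
  case (3 a b xs)
  then have "(last (b # xs), b) \<in> {(a, b). {a, b} \<in> T}\<^sup>*" and "{b, a} \<in> T"
    by (auto simp: insert_commute)
  then have "(last (b # xs), a) \<in> {(a, b). {a, b} \<in> T}\<^sup>*"
    by (auto intro: rtrancl_into_rtrancl)
  then show ?case by simp
qed auto

lemma cycle_from_path:
  assumes "distinct xs" and "set xs \<subseteq> V" and path: "successively (\<lambda>a b. {a, b} \<in> T) xs"
    and j: "2 \<le> j" "j < length xs" and close: "{xs ! j, hd xs} \<in> T" and "T \<subseteq> E"
  obtains C where "simple_cycle V E C" "C \<subseteq> T"
proof
  let ?ys = "take (Suc j) xs"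
  have len: "length ?ys = Suc j" using j by simp
  have "e \<in> T" if "e \<in> cycle_edges ?ys" for e
  proof -
    from that have "\<exists>i. e = {?ys ! i, ?ys ! (Suc i mod Suc j)} \<and> i < Suc j"
      unfolding cycle_edges_def len by (rule CollectD)
    then obtain i where i: "i < Suc j" "e = {?ys ! i, ?ys ! (Suc i mod Suc j)}" by (elim exE conjE)
    show ?thesis
    proof (cases "i = j")
      case True
      moreover have "hd xs = xs ! 0" using j by (intro hd_conv_nth) auto
      ultimately show ?thesis using i j close by simp
    next
      case False
      then have "e = {xs ! i, xs ! Suc i}" using i j by simp
      then show ?thesis using path False i j by (auto simp: successively_conv_nth)
    qed
  qed
  then show "cycle_edges ?ys \<subseteq> T" by blast
  then show "simple_cycle V E (cycle_edges ?ys)"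
    unfolding simple_cycle_def using assms len
    by (intro exI[of _ ?ys]) (auto dest: in_set_takeD)
qed

text \<open>
  The end of a maximal path has all its neighbours on the path. If it has a neighbour besides its
  successor, the edge to that neighbour closes a cycle of length at least three.
\<close>

lemma cycle_if_maximal_path_end_degree:
  assumes "finite V" and T: "T \<subseteq> complete_edges V"
    and xs: "xs \<noteq> []" "distinct xs" "set xs \<subseteq> V" "successively (\<lambda>a b. {a, b} \<in> T) xs"
    and max: "\<And>z. z \<in> V \<Longrightarrow> {z, hd xs} \<in> T \<Longrightarrow> z \<in> set xs"
    and deg: "2 \<le> degree T (hd xs)"
  obtains C where "simple_cycle V (complete_edges V) C" "C \<subseteq> T"
proof -
  let ?y = "hd xs"
  have "\<exists>f \<in> {f \<in> T. ?y \<in> f}. f \<noteq> {?y, xs ! 1}"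
  proof (rule ccontr)
    assume "\<not> ?thesis"
    then have "{f \<in> T. ?y \<in> f} \<subseteq> {{?y, xs ! 1}}" by blast
    then have "degree T ?y \<le> card {{?y, xs ! 1}}" unfolding degree_def by (intro card_mono) auto
    then show False using deg by simp
  qed
  then obtain f where f: "f \<in> T" "?y \<in> f" "f \<noteq> {?y, xs ! 1}" by blast
  then obtain z where z: "f = {z, ?y}" "z \<noteq> ?y" "z \<in> V"
    using T by (blast elim: complete_edgesD)
  then have "z \<in> set xs" using max f by blast
  then obtain j where j: "j < length xs" "z = xs ! j" by (auto simp: in_set_conv_nth)
  have "j \<noteq> 0" using j z xs(1) by (metis hd_conv_nth)
  moreover have "j \<noteq> 1" using j z f(3) by (auto simp: insert_commute)
  ultimately have "2 \<le> j" by simp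
  then show ?thesis
    using cycle_from_path[OF xs(2-4) _ j(1) _ T] j z f(1) that by blast
qed

section \<open>Maximal subtour-free edge sets are tours\<close>

definition partial_tour :: "'v set \<Rightarrow> 'v set set \<Rightarrow> bool" where
  "partial_tour V S \<longleftrightarrow> S \<subseteq> complete_edges V \<and> (\<forall>v\<in>V. degree S v \<le> 2) \<and>
     \<not> (\<exists>C. subtour V (complete_edges V) C \<and> C \<subseteq> S)"

lemma partial_tour_insert:
  assumes "finite V" and S: "partial_tour V S" and e: "e \<in> complete_edges V"
    and add: "can_add V (complete_edges V) S e"
  shows "partial_tour V (S \<union> {e})"
proof -
  have "finite S"
    using S assms(1) finite_complete_edges finite_subset by (auto simp: partial_tour_def)
  have "degree (S \<union> {e}) v \<le> 2" if "v \<in> V" for v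
  proof (cases "e \<in> S")
    case True
    then show ?thesis using S that by (auto simp: partial_tour_def insert_absorb)
  next
    case False
    have "v \<in> e \<Longrightarrow> degree S v < 2" "degree S v \<le> 2"
      using add S that by (simp_all add: can_add_def partial_tour_def)
    then show ?thesis using degree_insert[OF \<open>finite S\<close> False, of v] by auto
  qed
  moreover have "\<not> (\<exists>C. subtour V (complete_edges V) C \<and> C \<subseteq> S \<union> {e})"
  proof
    assume "\<exists>C. subtour V (complete_edges V) C \<and> C \<subseteq> S \<union> {e}"
    then obtain C where C: "subtour V (complete_edges V) C" "C \<subseteq> S \<union> {e}" by blast
    then have "e \<notin> C" using add unfolding can_add_def by blast
    then have "C \<subseteq> S" using C(2) by blast
    then show False using C(1) S unfolding partial_tour_def by blast
  qed
  ultimately show ?thesis using S e by (auto simp: partial_tour_def)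
qed

text \<open>
  The cycle is a tour, so it has \<open>card V\<close> edges; the degree bound leaves no room for more.
\<close>

lemma cycle_in_partial_tour:
  assumes "finite V" and "partial_tour V T" and "simple_cycle V (complete_edges V) C" and "C \<subseteq> T"
  shows "T \<in> tours V (complete_edges V)"
proof -
  have C: "C \<in> tours V (complete_edges V)"
    using assms(2-4) by (auto simp: partial_tour_def subtour_def)
  have T: "T \<subseteq> complete_edges V" "\<And>v. v \<in> V \<Longrightarrow> degree T v \<le> 2"
    using assms(2) by (auto simp: partial_tour_def)
  have "finite T" using T(1) assms(1) finite_complete_edges finite_subset by blast
  have "2 * card T \<le> (\<Sum>v\<in>V. 2)"
    unfolding handshake[OF assms(1) T(1), symmetric] by (intro sum_mono T(2))
  then have "card T \<le> card C" using tourD(2)[OF assms(1) C] by simp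
  then have "C = T" using \<open>finite T\<close> assms(4) by (metis card_seteq)
  then show ?thesis using C by simp
qed

lemma tour_if_all_degrees_two:
  assumes "finite V" and "V \<noteq> {}" and T: "partial_tour V T"
    and deg: "\<And>v. v \<in> V \<Longrightarrow> 2 \<le> degree T v"
  shows "T \<in> tours V (complete_edges V)"
proof -
  obtain x where "x \<in> V" using assms(2) by blast
  obtain xs where xs: "xs \<noteq> []" "distinct xs" "set xs \<subseteq> V" "successively (\<lambda>a b. {a, b} \<in> T) xs"
    "\<And>z. z \<in> V \<Longrightarrow> {z, hd xs} \<in> T \<Longrightarrow> z \<in> set xs"
    using maximal_path[OF assms(1) \<open>x \<in> V\<close>, of T] by metis
  have "T \<subseteq> complete_edges V" using T by (simp add: partial_tour_def)
  moreover have "2 \<le> degree T (hd xs)" using deg xs(1,3) by (meson hd_in_set subsetD)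
  ultimately obtain C where "simple_cycle V (complete_edges V) C" "C \<subseteq> T"
    using cycle_if_maximal_path_end_degree[OF assms(1) _ xs] by blast
  then show ?thesis by (rule cycle_in_partial_tour[OF assms(1) T])
qed

text \<open>
  Every component contains a vertex of degree below \<open>2\<close>: the end of a maximal path from \<open>x\<close>, since
  otherwise there would be a cycle. It can coincide with \<open>x\<close> only if \<open>x\<close> is isolated, which yields
  a second such vertex when \<open>x\<close> itself has degree \<open>1\<close>.
\<close>

lemma low_degree_end:
  assumes "finite V" and T: "partial_tour V T" and "T \<notin> tours V (complete_edges V)" and "x \<in> V"
  obtains y where "y \<in> V" "degree T y < 2" "(x, y) \<in> {(a, b). {a, b} \<in> T}\<^sup>*"
    "y = x \<Longrightarrow> degree T x = 0"
proof -
  have sub: "T \<subseteq> complete_edges V" using T by (simp add: partial_tour_def)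
  obtain xs where xs: "xs \<noteq> []" "distinct xs" "set xs \<subseteq> V" "successively (\<lambda>a b. {a, b} \<in> T) xs"
    "\<And>z. z \<in> V \<Longrightarrow> {z, hd xs} \<in> T \<Longrightarrow> z \<in> set xs" and last: "last xs = x"
    using maximal_path[OF assms(1,4), of T] by metis
  show ?thesis
  proof
    show "hd xs \<in> V" using xs(1,3) by auto
    show "degree T (hd xs) < 2"
    proof (rule ccontr)
      assume "\<not> ?thesis"
      then obtain C where "simple_cycle V (complete_edges V) C" "C \<subseteq> T"
        using cycle_if_maximal_path_end_degree[OF assms(1) sub xs] by force
      then show False using cycle_in_partial_tour[OF assms(1) T] assms(3) by blast
    qed
    show "(x, hd xs) \<in> {(a, b). {a, b} \<in> T}\<^sup>*"
      using successively_reachable[OF xs(4,1)] last by simp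
    show "degree T x = 0" if "hd xs = x"
    proof -
      have "xs = [x]" using that last xs(1,2) by (cases xs) (auto split: if_splits)
      then have "{f \<in> T. x \<in> f} = {}"
        using xs(5) sub by (auto elim!: complete_edgesD dest!: subsetD) (metis insert_commute)+
      then show ?thesis by (simp only: degree_def card.empty)
    qed
  qed
qed

text \<open>
  Let \<open>X\<close> be the component of a vertex \<open>u\<close> of degree below \<open>2\<close>. If \<open>X\<close> misses a vertex, then some
  vertex of degree below \<open>2\<close> lies outside \<open>X\<close>; joining it to \<open>u\<close> creates no cycle at all, because
  the new edge alone would cross the cut. If \<open>X = V\<close>, then \<open>u\<close> is joined to the other
  low-degree vertex; a cycle through the new edge is closed under adjacency, hence a tour.
\<close>

lemma low_degree_edge_addable:
  assumes "finite V" and "3 \<le> card V" and T: "partial_tour V T"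
    and no_tour: "T \<notin> tours V (complete_edges V)"
  obtains e where "e \<in> complete_edges V" "e \<notin> T" "can_add V (complete_edges V) T e"
proof -
  let ?K = "complete_edges V"
  let ?R = "{(a, b). {a, b} \<in> T}"
  have sub: "T \<subseteq> ?K" and deg: "\<And>v. v \<in> V \<Longrightarrow> degree T v \<le> 2"
    using T by (auto simp: partial_tour_def)
  have "finite T" using sub assms(1) finite_complete_edges finite_subset by blast
  have "V \<noteq> {}" using assms(2) by auto
  then obtain u where u: "u \<in> V" "degree T u < 2"
    using tour_if_all_degrees_two[OF assms(1) _ T] no_tour by (meson not_less)
  define X where "X = {x. (u, x) \<in> ?R\<^sup>*}"
  have "u \<in> X" by (simp add: X_def)
  have step: "b \<in> X" if "a \<in> X" "{a, b} \<in> T" for a b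
    using that by (auto simp: X_def intro: rtrancl_into_rtrancl)
  have closed: "f \<subseteq> X \<or> f \<inter> X = {}" if "f \<in> T" for f
  proof -
    obtain a b where "f = {a, b}" using \<open>f \<in> T\<close> sub by (blast elim: complete_edgesD)
    then show ?thesis using that step[of a b] step[of b a] by (auto simp: insert_commute)
  qed
  \<comment> \<open>Several steps show that a vertex set is everything by showing that it is closed.\<close>
  have X_least: "X \<subseteq> Y" if "u \<in> Y" and Y: "\<And>f. f \<in> T \<Longrightarrow> f \<inter> Y \<noteq> {} \<Longrightarrow> f \<subseteq> Y" for Y
  proof
    fix x assume "x \<in> X"
    then have "(u, x) \<in> ?R\<^sup>*" by (simp add: X_def)
    then show "x \<in> Y" by (induction rule: rtrancl_induct) (use that in blast)+
  qed
  have "X \<subseteq> V"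
    using sub u(1) by (intro X_least) (auto simp: complete_edges_def)
  show ?thesis
  proof (cases "X = V")
    case False
    then obtain x where x: "x \<in> V" "x \<notin> X" using \<open>X \<subseteq> V\<close> by blast
    obtain y where y: "y \<in> V" "degree T y < 2" "(x, y) \<in> ?R\<^sup>*"
      using low_degree_end[OF assms(1) T no_tour x(1)] by metis
    have "y \<notin> X"
      using y(3)
    proof (induction rule: rtrancl_induct)
      case (step a b)
      then have "{a, b} \<in> T" by simp
      then show ?case using closed[of "{a, b}"] step.IH by blast
    qed (rule x(2))
    let ?e = "{u, y}"
    have "u \<noteq> y" using \<open>u \<in> X\<close> \<open>y \<notin> X\<close> by blast
    have "?e \<notin> T" using closed[of ?e] \<open>u \<in> X\<close> \<open>y \<notin> X\<close> by blast
    have "False" if C: "subtour V ?K C" "C \<subseteq> T \<union> {?e}" "?e \<in> C" for C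
    proof -
      have "simple_cycle V ?K C" using C(1) by (simp add: subtour_def)
      then have "card (X \<inter> ?e) \<noteq> 1"
        using C closed by (intro cycle_cut_even[OF _ assms(1) C(3) \<open>X \<subseteq> V\<close>]) auto
      moreover have "X \<inter> ?e = {u}" using \<open>u \<in> X\<close> \<open>y \<notin> X\<close> by blast
      ultimately show False by simp
    qed
    then have "can_add V ?K T ?e" using u y by (auto simp: can_add_def)
    moreover have "?e \<in> ?K" using u y \<open>u \<noteq> y\<close> by (simp add: complete_edges_def)
    ultimately show ?thesis using that \<open>?e \<notin> T\<close> by blast
  next
    case True
    obtain y where y: "y \<in> V" "degree T y < 2" and yu: "y = u \<Longrightarrow> degree T u = 0"
      using low_degree_end[OF assms(1) T no_tour u(1)] by metis
    have big: "\<not> V \<subseteq> {u, y}"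
    proof
      assume "V \<subseteq> {u, y}"
      then have "card V \<le> card {u, y}" by (intro card_mono) auto
      also have "\<dots> \<le> 2" by (simp add: card_insert_if)
      finally show False using assms(2) by simp
    qed
    let ?e = "{u, y}"
    have "u \<noteq> y"
    proof
      assume "u = y"
      then have "{f \<in> T. u \<in> f} = {}" using yu \<open>finite T\<close> by (simp add: degree_def)
      then have "X \<subseteq> {u}" by (intro X_least) auto
      then show False using True big by auto
    qed
    \<comment> \<open>If \<open>u\<close> and \<open>y\<close> were adjacent, they would form a whole component.\<close>
    have only: "f = ?e" if "?e \<in> T" "f \<in> T" "v \<in> f" "v \<in> ?e" for f v
    proof (rule ccontr)
      assume "f \<noteq> ?e"
      then have "card {f, ?e} = 2" by simp
      moreover have "card {f, ?e} \<le> degree T v"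
        unfolding degree_def using \<open>finite T\<close> that by (intro card_mono) auto
      ultimately show False using u(2) y(2) that(4) by auto
    qed
    have "?e \<notin> T"
    proof
      assume "?e \<in> T"
      then have "X \<subseteq> ?e" using only by (intro X_least) blast+
      then show False using True big by auto
    qed
    have deg': "degree (T \<union> {?e}) v \<le> 2" if "v \<in> V" for v
      using degree_insert[OF \<open>finite T\<close> \<open>?e \<notin> T\<close>, of v] u y deg[OF that] by auto
    have "False" if C: "subtour V ?K C" "C \<subseteq> T \<union> {?e}" "?e \<in> C" for C
    proof -
      have cyc: "simple_cycle V ?K C" using C(1) by (simp add: subtour_def)
      then have CV: "\<Union>C \<subseteq> V" using simple_cycle_subset by (fastforce simp: complete_edges_def)
      have "f \<subseteq> \<Union>C" if f: "f \<in> T" "f \<inter> \<Union>C \<noteq> {}" for f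
      proof -
        obtain v where "v \<in> f" "v \<in> \<Union>C" using f(2) by blast
        then have "f \<in> C"
          using saturated_cycle_closed[OF cyc C(2) _ deg'] f(1) \<open>finite T\<close> CV by blast
        then show ?thesis by blast
      qed
      then have "X \<subseteq> \<Union>C" using C(3) by (intro X_least) blast+
      then have "C \<in> tours V ?K" using True CV cyc by (auto simp: tours_def)
      then show False using C(1) by (simp add: subtour_def)
    qed
    then have "can_add V ?K T ?e" using u y by (auto simp: can_add_def)
    moreover have "?e \<in> ?K" using u y \<open>u \<noteq> y\<close> by (simp add: complete_edges_def)
    ultimately show ?thesis using that \<open>?e \<notin> T\<close> by blast
  qed
qed

section \<open>Runs of the greedy algorithm\<close>

lemma can_add_antimono:
  assumes "can_add V E T e" and "S \<subseteq> T" and "finite T"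
  shows "can_add V E S e"
proof -
  have "degree S v < 2" if "v \<in> e" for v
  proof -
    have "degree T v < 2" using assms(1) that unfolding can_add_def by blast
    then show ?thesis using degree_mono[OF assms(3,2), of v] by simp
  qed
  moreover have "C \<subseteq> T \<union> {e}" if "C \<subseteq> S \<union> {e}" for C using that assms(2) by blast
  ultimately show ?thesis using assms(1) unfolding can_add_def by blast
qed

text \<open>
  An edge is rejected either because one end has degree \<open>2\<close> or because it closes a subtour, and then
  the neighbouring edges of that subtour give both ends degree at least \<open>1\<close>.
\<close>

lemma rejected_edge_degree_sum:
  assumes "finite S" and e: "e \<in> complete_edges V" and rej: "\<not> can_add V (complete_edges V) S e"
  shows "2 \<le> (\<Sum>v\<in>e. degree S v)"
proof -
  obtain a b where ab: "e = {a, b}" "a \<noteq> b" using e by (rule complete_edgesD)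
  consider v where "v \<in> e" "2 \<le> degree S v"
    | C where "simple_cycle V (complete_edges V) C" "C \<subseteq> S \<union> {e}" "e \<in> C"
    using rej unfolding can_add_def subtour_def not_less[symmetric] by blast
  then show ?thesis
  proof cases
    case 1
    then show ?thesis using ab by auto
  next
    case 2
    have "1 \<le> degree S v" if "v \<in> e" for v
    proof -
      have "2 = degree C v" using degree_simple_cycle[OF 2(1)] 2(3) that by auto
      also have "\<dots> \<le> degree (insert e (S - {e})) v" using 2 assms(1) by (intro degree_mono) auto
      also have "\<dots> = degree (S - {e}) v + 1"
        using degree_insert[of "S - {e}" e v] assms(1) that by simp
      also have "\<dots> \<le> degree S v + 1" using assms(1) by (simp add: degree_mono)
      finally show ?thesis by simp
    qed
    from this[of a] this[of b] show ?thesis using ab by simp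
  qed
qed

text \<open>
  The last conjunct says that rejection is permanent: degrees and cycles only grow with \<open>S\<close>, so an
  edge that was rejected earlier is still not addable now.
\<close>

definition greedy_invar :: "'v set \<Rightarrow> 'v set set \<times> 'v set set \<Rightarrow> bool" where
  "greedy_invar V = (\<lambda>(S, C). partial_tour V S \<and> C \<subseteq> complete_edges V \<and> S \<inter> C = {} \<and>
     (\<forall>e \<in> complete_edges V - C - S. \<not> can_add V (complete_edges V) S e))"

lemma greedy_invar_step:
  assumes "finite V" and "greedy_step V (complete_edges V) f s s'" and "greedy_invar V s"
  shows "greedy_invar V s'"
  using assms(2)
proof cases
  case (add C S e)
  have inv: "partial_tour V S" "C \<subseteq> complete_edges V" "S \<inter> C = {}"
    "\<forall>e \<in> complete_edges V - C - S. \<not> can_add V (complete_edges V) S e"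
    using assms(3) unfolding add(1) greedy_invar_def prod.case by blast+
  have e: "e \<in> C" using add by (simp add: is_arg_max_def)
  have T: "partial_tour V (S \<union> {e})"
    using partial_tour_insert[OF assms(1) inv(1) _ add(6)] inv(2) e by blast
  then have "S \<union> {e} \<subseteq> complete_edges V" unfolding partial_tour_def by blast
  then have fin: "finite (S \<union> {e})"
    by (rule finite_subset) (rule finite_complete_edges[OF assms(1)])
  have "\<not> can_add V (complete_edges V) (S \<union> {e}) e'" if "e' \<in> complete_edges V - C - S" for e'
    using can_add_antimono[OF _ _ fin, of V "complete_edges V" e' S] inv(4) that by blast
  then have "\<forall>e' \<in> complete_edges V - (C - {e}) - (S \<union> {e}).
      \<not> can_add V (complete_edges V) (S \<union> {e}) e'"
    by blast
  then show ?thesis using T inv(2,3) unfolding add(2) greedy_invar_def prod.case by blast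
next
  case (skip C S e)
  then show ?thesis using assms(3) unfolding skip(1,2) greedy_invar_def prod.case by blast
qed

lemma greedy_invar_reachable:
  assumes "finite V" and "(greedy_step V (complete_edges V) f)\<^sup>*\<^sup>* ({}, complete_edges V) s"
  shows "greedy_invar V s"
  using assms(2)
proof (induction rule: rtranclp_induct)
  case base
  have "C \<noteq> {}" if C: "simple_cycle V (complete_edges V) C" for C
  proof -
    obtain xs where "3 \<le> length xs" "C = cycle_edges xs" using C unfolding simple_cycle_def by blast
    then show ?thesis using Union_cycle_edges[of xs] by (cases xs) auto
  qed
  then have "\<not> (\<exists>C. subtour V (complete_edges V) C \<and> C \<subseteq> {})" unfolding subtour_def by blast
  then have "partial_tour V {}" unfolding partial_tour_def by (simp add: degree_def)
  then show ?case by (simp add: greedy_invar_def)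
next
  case (step s s')
  then show ?case using greedy_invar_step[OF assms(1)] by blast
qed

text \<open>
  If the output is not a tour, it has a vertex of degree below \<open>2\<close> and so fewer than \<open>card V\<close> edges.
  The run therefore ended because all candidates were examined, and every edge outside the output
  is permanently rejected, contrary to \<open>low_degree_edge_addable\<close>.
\<close>

lemma greedy_output_tour:
  assumes "finite V" and "3 \<le> card V" and inv: "greedy_invar V (T, C)"
    and stop: "\<not> (C \<noteq> {} \<and> card T < card V)"
  shows "T \<in> tours V (complete_edges V)"
proof (rule ccontr)
  assume no_tour: "T \<notin> tours V (complete_edges V)"
  have T: "partial_tour V T" using inv by (simp add: greedy_invar_def)
  then have sub: "T \<subseteq> complete_edges V" and deg: "\<And>v. v \<in> V \<Longrightarrow> degree T v \<le> 2"
    by (auto simp: partial_tour_def)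
  have "V \<noteq> {}" using assms(2) by auto
  then obtain u where u: "u \<in> V" "degree T u < 2"
    using tour_if_all_degrees_two[OF assms(1) _ T] no_tour by (meson not_less)
  have "(\<Sum>v\<in>V. degree T v) < (\<Sum>v\<in>V. 2)"
    by (rule sum_strict_mono_ex1[OF assms(1)]) (use u deg in auto)
  then have "card T < card V" by (simp add: handshake[OF assms(1) sub])
  then have "C = {}" using stop by blast
  then show False
    using low_degree_edge_addable[OF assms(1,2) T no_tour] inv by (auto simp: greedy_invar_def)
qed

lemma greedy_terminates:
  assumes "finite C"
  shows "\<exists>T D. (greedy_step V E f)\<^sup>*\<^sup>* (S, C) (T, D) \<and> \<not> (D \<noteq> {} \<and> card T < card V)"
  using assms
proof (induction C arbitrary: S rule: finite_psubset_induct)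
  case (psubset C)
  show ?case
  proof (cases "C \<noteq> {} \<and> card S < card V")
    case True
    let ?gain = "\<lambda>e. f (S \<union> {e}) - f S"
    have "Max (?gain ` C) \<in> ?gain ` C" using True psubset(1) by (intro Max_in) auto
    then obtain e where "e \<in> C" "?gain e = Max (?gain ` C)" by fastforce
    then have e: "is_arg_max ?gain (\<lambda>e. e \<in> C) e"
      unfolding is_arg_max_linorder using psubset(1) by auto
    have "\<exists>S'. greedy_step V E f (S, C) (S', C - {e})"
      using greedy_step.intros[OF _ _ e] True by blast
    then obtain S' where step: "greedy_step V E f (S, C) (S', C - {e})" by blast
    then have "C - {e} \<subset> C" by (rule greedy_step_candidates)
    from psubset.IH[OF this] show ?thesis
      using step by (meson converse_rtranclp_into_rtranclp)
  next
    case False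
    then show ?thesis by blast
  qed
qed

section \<open>Amortised analysis\<close>

definition marginal :: "('e set \<Rightarrow> real) \<Rightarrow> 'e set \<Rightarrow> 'e \<Rightarrow> real" where
  "marginal g S e = g (insert e S) - g S"

lemma marginal_nonneg:
  "mono_on (Pow E) g \<Longrightarrow> S \<subseteq> E \<Longrightarrow> e \<in> E \<Longrightarrow> 0 \<le> marginal g S e"
  unfolding marginal_def by (auto intro: mono_onD)

lemma marginal_antimono:
  assumes mono: "mono_on (Pow E) g" and subm: "submodular_on E g"
    and "S \<subseteq> T" and "T \<subseteq> E" and "e \<in> E"
  shows "marginal g T e \<le> marginal g S e"
proof (cases "e \<in> T")
  case True
  then show ?thesis
    using marginal_nonneg[OF mono, of S e] assms(3-5) by (auto simp: marginal_def insert_absorb)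
next
  case False
  have "insert e S \<subseteq> E" using assms(3-5) by blast
  then have "g (insert e S \<union> T) + g (insert e S \<inter> T) \<le> g (insert e S) + g T"
    using subm assms(4) unfolding submodular_on_def by (elim allE impE)
  moreover have "insert e S \<union> T = insert e T" "insert e S \<inter> T = S" using assms False by auto
  ultimately show ?thesis by (simp add: marginal_def)
qed

lemma le_sum_marginals:
  assumes mono: "mono_on (Pow E) g" and subm: "submodular_on E g"
    and "finite Q" and "Q \<subseteq> E" and "S \<subseteq> E"
  shows "g (S \<union> Q) \<le> g S + (\<Sum>e\<in>Q. marginal g S e)"
  using assms(3,4)
proof (induction Q)
  case (insert e Q)
  have "g (S \<union> insert e Q) = g (S \<union> Q) + marginal g (S \<union> Q) e" by (simp add: marginal_def)
  moreover have "marginal g (S \<union> Q) e \<le> marginal g S e"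
    using insert assms(5) by (intro marginal_antimono[OF mono subm]) auto
  ultimately show ?case using insert by simp
qed simp

text \<open>
  The amortisation invariant for comparison with \<open>Q\<close>. Every accepted edge contributes two units of
  credit and every examined edge of \<open>Q\<close> consumes one, so \<open>2 * card S - card (Q - C)\<close> units are
  unspent. Each of them is still worth at least any marginal \<open>d\<close> of a remaining candidate, as
  gains decrease along the run. The value \<open>d = 0\<close> is included for the case that no candidate is left.
\<close>

definition charged :: "('e set \<Rightarrow> real) \<Rightarrow> 'e set \<Rightarrow> 'e set \<Rightarrow> 'e set \<times> 'e set \<Rightarrow> bool" where
  "charged g E Q = (\<lambda>(S, C). \<forall>d \<in> insert 0 (marginal g S ` C).
     (\<Sum>e\<in>Q - C. marginal g S e) + (2 * real (card S) - real (card (Q - C))) * d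
       \<le> 2 * (g S - g {}))"

text \<open>
  Let \<open>\<delta>\<close> be the largest candidate marginal, attained by \<open>e\<close>. Accepting \<open>e\<close> raises the right-hand
  side by \<open>2 * \<delta>\<close>, which pays for two new units of credit; if \<open>e\<close> lies in \<open>Q\<close>, one unit is traded
  for the new summand \<open>\<delta>\<close>. Later marginals are at most \<open>\<delta>\<close> by submodularity, and the
  nonnegative number of unspent units lets \<open>\<delta>\<close> be lowered to any of them.
\<close>

lemma charged_step:
  assumes "finite E" and mono: "mono_on (Pow E) g" and subm: "submodular_on E g"
    and SE: "S \<subseteq> E" and CE: "C \<subseteq> E" and QE: "Q \<subseteq> E"
    and e: "e \<in> C" and disj: "S \<inter> C = {}"
    and max: "\<And>e'. e' \<in> C \<Longrightarrow> marginal g S e' \<le> marginal g S e"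
    and inv: "charged g E Q (S, C)"
    and S': "S' = S \<or> S' = insert e S"
    and count: "card (Q - (C - {e})) \<le> 2 * card S'"
  shows "charged g E Q (S', C - {e})"
proof -
  define \<delta> where "\<delta> = marginal g S e"
  define A where "A = Q - C"
  define A' where "A' = Q - (C - {e})"
  have fin: "finite S" "finite Q" "finite A"
    using finite_subset[OF SE assms(1)] finite_subset[OF QE assms(1)] by (auto simp: A_def)
  have "0 \<le> \<delta>" using marginal_nonneg[OF mono SE] e CE by (auto simp: \<delta>_def)
  have S'E: "S \<subseteq> S'" "S' \<subseteq> E" using S' SE CE e by auto
  have card_S': "card S' = card S + (if S' = S then 0 else 1)"
  proof -
    have "e \<notin> S" using e disj by blast
    then show ?thesis using S' fin(1) by (cases "S' = S") simp_all
  qed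
  have gS': "g S' = g S + (if S' = S then 0 else \<delta>)"
    using S' by (cases "S' = S") (simp_all add: \<delta>_def marginal_def)
  have card_A': "real (card A') = real (card A) + (if e \<in> Q then 1 else 0)"
    and sum_A': "(\<Sum>x\<in>A'. marginal g S x) = (\<Sum>x\<in>A. marginal g S x) + (if e \<in> Q then \<delta> else 0)"
  proof -
    have A': "A' = (if e \<in> Q then insert e A else A)" using e by (auto simp: A_def A'_def)
    have "e \<notin> A" using e by (simp add: A_def)
    then show "real (card A') = real (card A) + (if e \<in> Q then 1 else 0)"
      "(\<Sum>x\<in>A'. marginal g S x) = (\<Sum>x\<in>A. marginal g S x) + (if e \<in> Q then \<delta> else 0)"
      unfolding A' using fin(3) by (simp_all add: \<delta>_def)
  qed
  have old: "(\<Sum>x\<in>A. marginal g S x) + (2 * real (card S) - real (card A)) * \<delta> \<le> 2 * (g S - g {})"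
    using inv e unfolding charged_def prod.case A_def \<delta>_def by blast
  have new: "(\<Sum>x\<in>A'. marginal g S x) + (2 * real (card S') - real (card A')) * \<delta>
      \<le> 2 * (g S' - g {})"
    using old unfolding card_S' gS' card_A' sum_A'
    by (cases "S' = S"; cases "e \<in> Q") (simp_all add: algebra_simps)
  have "(\<Sum>x\<in>A'. marginal g S' x) + (2 * real (card S') - real (card A')) * d \<le> 2 * (g S' - g {})"
    if d: "d \<in> insert 0 (marginal g S' ` (C - {e}))" for d
  proof -
    have "d \<le> \<delta>"
    proof (cases "d = 0")
      case False
      then obtain e' where e': "e' \<in> C" "d = marginal g S' e'" using d by blast
      then have "d \<le> marginal g S e'"
        using marginal_antimono[OF mono subm S'E, of e'] CE by auto
      then show ?thesis using max[OF e'(1)] by (simp add: \<delta>_def)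
    qed (use \<open>0 \<le> \<delta>\<close> in simp)
    moreover have "0 \<le> 2 * real (card S') - real (card A')"
      using count by (simp add: A'_def)
    ultimately have "(2 * real (card S') - real (card A')) * d
        \<le> (2 * real (card S') - real (card A')) * \<delta>"
      by (rule mult_left_mono)
    moreover have "(\<Sum>x\<in>A'. marginal g S' x) \<le> (\<Sum>x\<in>A'. marginal g S x)"
      using QE by (intro sum_mono marginal_antimono[OF mono subm S'E]) (auto simp: A'_def)
    ultimately show ?thesis using new by linarith
  qed
  then show ?thesis unfolding charged_def prod.case A'_def[symmetric] by blast
qed

text \<open>
  The run may stop with candidates left. The unexamined edges of \<open>Q\<close> have marginal at most \<open>d\<close>, the
  largest remaining one, and the unspent credit covers all of them.
\<close>

lemma charged_bound:
  assumes "finite E" and mono: "mono_on (Pow E) g" and subm: "submodular_on E g"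
    and SE: "S \<subseteq> E" and CE: "C \<subseteq> E" and QE: "Q \<subseteq> E"
    and inv: "charged g E Q (S, C)" and card: "card Q \<le> 2 * card S"
  shows "g Q + 2 * g {} \<le> 3 * g S"
proof -
  have fin: "finite Q" "finite C" using assms(1) QE CE finite_subset by auto
  have QC: "Q = (Q - C) \<union> (Q \<inter> C)" by blast
  have cardQ: "card Q = card (Q - C) + card (Q \<inter> C)"
    by (subst QC, rule card_Un_disjoint) (use fin in auto)
  have sumQ: "(\<Sum>e\<in>Q. marginal g S e)
      = (\<Sum>e\<in>Q - C. marginal g S e) + (\<Sum>e\<in>Q \<inter> C. marginal g S e)"
    by (subst QC, rule sum.union_disjoint) (use fin in auto)
  define d where "d = Max (insert 0 (marginal g S ` C))"
  have d: "d \<in> insert 0 (marginal g S ` C)" unfolding d_def using fin by (intro Max_in) auto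
  have "0 \<le> d" unfolding d_def using fin by (intro Max_ge) auto
  have "(\<Sum>e\<in>Q \<inter> C. marginal g S e) \<le> (\<Sum>e\<in>Q \<inter> C. d)"
    unfolding d_def using fin by (intro sum_mono Max_ge) auto
  also have "\<dots> = real (card (Q \<inter> C)) * d" by simp
  also have "\<dots> \<le> (2 * real (card S) - real (card (Q - C))) * d"
    using card cardQ \<open>0 \<le> d\<close> by (intro mult_right_mono) auto
  finally have "(\<Sum>e\<in>Q. marginal g S e) \<le> 2 * (g S - g {})"
    using inv d sumQ by (fastforce simp: charged_def)
  moreover have "g Q \<le> g (S \<union> Q)" using mono SE QE by (auto intro: mono_onD)
  ultimately show ?thesis using le_sum_marginals[OF mono subm fin(1) QE SE] by argo
qed

text \<open>
  The algorithm is run with \<open>f\<close> but analysed with \<open>g\<close>; the hypothesis on marginals makes the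
  maximising candidates of both agree, as candidates are never in \<open>S\<close>.
\<close>

lemma greedy_charged:
  assumes "finite V" and mono: "mono_on (Pow (complete_edges V)) g"
    and subm: "submodular_on (complete_edges V) g"
    and shift: "\<And>S e. finite S \<Longrightarrow> e \<notin> S \<Longrightarrow> f (insert e S) - f S = marginal g S e - k"
    and Q: "Q \<subseteq> complete_edges V" "\<And>v. v \<in> V \<Longrightarrow> degree Q v \<le> 2"
    and run: "(greedy_step V (complete_edges V) f)\<^sup>*\<^sup>* ({}, complete_edges V) s"
  shows "charged g (complete_edges V) Q s"
  using run
proof (induction rule: rtranclp_induct)
  case base
  have empty: "Q - complete_edges V = {}" using Q(1) by blast
  show ?case unfolding charged_def prod.case empty by simp
next
  case (step s s')
  have fin: "finite (complete_edges V)" by (rule finite_complete_edges[OF assms(1)])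
  have inv: "greedy_invar V s" by (rule greedy_invar_reachable[OF assms(1) step(1)])
  have inv': "greedy_invar V s'" by (rule greedy_invar_step[OF assms(1) step(2) inv])
  obtain S C e S' where s: "s = (S, C)" "s' = (S', C - {e})"
    and arg: "is_arg_max (\<lambda>e. f (S \<union> {e}) - f S) (\<lambda>e. e \<in> C) e"
    and S': "S' = S \<or> S' = insert e S"
    using step(2) by cases auto
  have S: "S \<subseteq> complete_edges V" "C \<subseteq> complete_edges V" "S \<inter> C = {}"
    using inv s by (auto simp: greedy_invar_def partial_tour_def)
  have S'E: "S' \<subseteq> complete_edges V"
    and rej: "\<And>x. x \<in> complete_edges V - (C - {e}) - S' \<Longrightarrow> \<not> can_add V (complete_edges V) S' x"
    using inv' s by (auto simp: greedy_invar_def partial_tour_def)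
  have finS: "finite S" "finite S'" using S(1) S'E fin finite_subset by auto
  have e: "e \<in> C" using arg by (simp add: is_arg_max_def)
  have max: "marginal g S e' \<le> marginal g S e" if "e' \<in> C" for e'
  proof -
    have "f (S \<union> {e'}) - f S \<le> f (S \<union> {e}) - f S"
      using arg that by (auto simp: is_arg_max_def not_less)
    moreover have "e \<notin> S" "e' \<notin> S" using S(3) e that by auto
    ultimately show ?thesis using shift[OF finS(1)] by simp
  qed
  \<comment> \<open>Every examined edge has been accepted or is not addable, which bounds its degree sum below.\<close>
  have count: "card (Q - (C - {e})) \<le> 2 * card S'"
  proof (rule card_le_twice_if_degrees_met[OF assms(1) S'E])
    show "Q - (C - {e}) \<subseteq> complete_edges V" using Q(1) by blast
    show "degree (Q - (C - {e})) v \<le> 2" if "v \<in> V" for v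
      using degree_mono[of Q "Q - (C - {e})" v] Q fin finite_subset that by (meson Diff_subset le_trans)
    show "2 \<le> (\<Sum>v\<in>x. degree S' v)" if x: "x \<in> Q - (C - {e})" for x
    proof (cases "x \<in> S'")
      case True
      have "1 \<le> degree S' v" if "v \<in> x" for v
        using True that finS(2) by (auto simp: degree_def Suc_le_eq card_gt_0_iff)
      then have "(\<Sum>v\<in>x. 1) \<le> (\<Sum>v\<in>x. degree S' v)" by (rule sum_mono)
      moreover have "card x = 2" using x Q(1) by (auto simp: complete_edges_def)
      ultimately show ?thesis by simp
    next
      case False
      then show ?thesis using x Q(1) rej by (intro rejected_edge_degree_sum[OF finS(2)]) auto
    qed
  qed
  show ?case
    unfolding s
    by (rule charged_step[OF fin mono subm S(1,2) Q(1) e S(3) max _ S' count]) (use step.IH s in auto)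
qed

section \<open>The approximation guarantee\<close>

lemma submodular_on_mixture:
  fixes w :: "'e set \<Rightarrow> real"
  assumes "finite E" and "submodular_on E w" and "0 \<le> a"
  shows "submodular_on E (\<lambda>S. a * w S + sum h S)"
  unfolding submodular_on_def
proof (intro allI impI)
  fix S T assume ST: "S \<subseteq> E" "T \<subseteq> E"
  have "a * (w (S \<union> T) + w (S \<inter> T)) \<le> a * (w S + w T)"
    using assms ST by (intro mult_left_mono) (auto simp: submodular_on_def)
  moreover have "sum h (S \<union> T) + sum h (S \<inter> T) = sum h S + sum h T"
    using assms(1) ST finite_subset by (intro sum.union_inter) blast+
  ultimately show "a * w (S \<union> T) + sum h (S \<union> T) + (a * w (S \<inter> T) + sum h (S \<inter> T))
      \<le> a * w S + sum h S + (a * w T + sum h T)"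
    by (simp add: algebra_simps)
qed

lemma mono_on_mixture:
  fixes w :: "'e set \<Rightarrow> real"
  assumes "finite E" and "mono_on (Pow E) w" and "0 \<le> a" and h: "\<And>e. e \<in> E \<Longrightarrow> 0 \<le> h e"
  shows "mono_on (Pow E) (\<lambda>S. a * w S + sum h S)"
proof (rule mono_onI)
  fix S T assume ST: "S \<in> Pow E" "T \<in> Pow E" "S \<subseteq> T"
  have "a * w S \<le> a * w T"
    by (rule mult_left_mono[OF mono_onD[OF assms(2) ST] assms(3)])
  moreover have "sum h S \<le> sum h T"
    using ST h finite_subset[OF _ assms(1)] by (intro sum_mono2) auto
  ultimately show "a * w S + sum h S \<le> a * w T + sum h T" by simp
qed

theorem mainTheorem6:
  fixes V :: "'v set" and E :: "'v set set"
    and w :: "'v set set \<Rightarrow> real" and c :: "'v set \<Rightarrow> real" and \<beta> :: real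
  assumes "finite V" and "3 \<le> card V" and "E = complete_edges V"
    and "\<And>S. S \<subseteq> E \<Longrightarrow> 0 \<le> w S"
    and "mono_on (Pow E) w"
    and "submodular_on E w"
    and "\<And>e. e \<in> E \<Longrightarrow> 0 \<le> c e"
    and "0 \<le> \<beta>" and "\<beta> \<le> 1"
  shows "(\<exists>T. greedy_output V E (objective \<beta> w c) T) \<and>
    (\<forall>T. greedy_output V E (objective \<beta> w c) T \<longrightarrow>
       T \<in> tours V E \<and>
       objective \<beta> w c T \<ge>
         1 / 3 * Max (objective \<beta> w c ` tours V E) - 2 / 3 * \<beta> * Max (c ` E) * real (card V))"
proof (intro conjI allI impI)
  let ?f = "objective \<beta> w c"
  have finE: "finite E" using finite_complete_edges[OF assms(1)] assms(3) by simp
  show "\<exists>T. greedy_output V E ?f T"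
    using greedy_terminates[OF finE] unfolding greedy_output_def by blast
  fix T assume "greedy_output V E ?f T"
  then obtain C where run: "(greedy_step V E ?f)\<^sup>*\<^sup>* ({}, E) (T, C)"
    and stop: "\<not> (C \<noteq> {} \<and> card T < card V)"
    by (auto simp: greedy_output_def)
  have inv: "greedy_invar V (T, C)"
    using greedy_invar_reachable[OF assms(1)] run assms(3) by simp
  show tour: "T \<in> tours V E"
    using greedy_output_tour[OF assms(1,2) inv stop] assms(3) by simp
  define M where "M = Max (c ` E)"
  \<comment> \<open>The shifted objective, written so that monotonicity and submodularity are visible.\<close>
  define g where "g S = (1 - \<beta>) * w S + (\<Sum>e\<in>S. \<beta> * (M - c e))" for S
  have g_eq: "g S = ?f S + \<beta> * M * real (card S)" for S
    by (simp add: g_def objective_def sum_distrib_left[symmetric] sum_subtractf algebra_simps)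
  have "0 \<le> \<beta> * (M - c e)" if "e \<in> E" for e
    using assms(8) finE that by (auto simp: M_def intro!: mult_nonneg_nonneg)
  then have mono: "mono_on (Pow E) g"
    unfolding g_def using assms(9) by (intro mono_on_mixture[OF finE assms(5)]) auto
  have subm: "submodular_on E g"
    unfolding g_def using assms(9) by (intro submodular_on_mixture[OF finE assms(6)]) auto
  have shift: "?f (insert e S) - ?f S = marginal g S e - \<beta> * M" if "finite S" "e \<notin> S" for S e
    using that by (simp add: marginal_def g_eq algebra_simps)
  have bound: "?f Q \<le> 3 * ?f T + 2 * \<beta> * M * real (card V)" if "Q \<in> tours V E" for Q
  proof -
    have Q: "Q \<subseteq> E" "card Q = card V" "\<And>v. v \<in> V \<Longrightarrow> degree Q v = 2"
      using tourD[OF assms(1)] that assms(3) by auto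
    have cardT: "card T = card V" using tourD(2)[OF assms(1)] tour assms(3) by simp
    have "charged g E Q (T, C)"
      unfolding assms(3)
      by (rule greedy_charged[OF assms(1), where f = ?f])
        (use mono subm shift Q run assms(3) in auto)
    moreover have "T \<subseteq> E" "C \<subseteq> E"
      using inv assms(3) by (auto simp: greedy_invar_def partial_tour_def)
    ultimately have "g Q + 2 * g {} \<le> 3 * g T"
      using Q(1,2) cardT by (intro charged_bound[OF finE mono subm]) auto
    moreover have "0 \<le> g {}" using assms(4,9) by (simp add: g_def)
    ultimately show ?thesis using g_eq Q(2) cardT by (simp add: algebra_simps)
  qed
  have "finite (tours V E)"
    by (rule finite_subset[of _ "Pow E"]) (use finE in \<open>auto simp: tours_def simple_cycle_def\<close>)
  then have "Max (?f ` tours V E) \<in> ?f ` tours V E" using tour by (intro Max_in) auto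
  then have "Max (?f ` tours V E) \<le> 3 * ?f T + 2 * \<beta> * M * real (card V)" using bound by auto
  then show "?f T \<ge> 1 / 3 * Max (?f ` tours V E) - 2 / 3 * \<beta> * Max (c ` E) * real (card V)"
    unfolding M_def[symmetric] by argo
qed

end
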